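(* Let $\mathcal{C}^B_6$ be the set of bordered $6$-cycles. Then \[ \mathrm{ex}_<(n,\mathcal{C}^B_6)=\Theta(n^{4/3})\qquad (n\to\infty). \]
   Context: An ordered graph is a finite simple graph together with a linear ordering of its vertex set. An ordered graph $G$ contains an ordered graph $H$ as an ordered subgraph if there is an injective, order-preserving map from the vertices of $H$ to the vertices of $G$ that maps edges of $H$ to edges of $G$ (the copy need not be induced). For a set $\mathcal{H}$ of ordered graphs, $\mathrm{ex}_<(n,\mathcal{H})$ is the maximum number of edges of an ordered graph on $n$ vertices that contains no $H\in\mathcal{H}$ as an ordered subgraph. The interval chromatic number of an ordered graph is the minimum number of intervals into which its linearly ordered vertex set can be partitioned so that no two vertices in the same interval are adjacent. In an ordered graph with interval chromatic number $2$ and intervals $U$ and $V$ ($U$ preceding $V$), an edge joining the first vertex of $U$ to the last vertex of $V$ is called an outer border, and an edge joining the last vertex of $U$ to the first vertex of $V$ is called an inner border. A bordered cycle is an ordered cycle (an ordered graph whose underlying graph is a cycle) with interval chromatic number $2$ that contains both an inner border and an outer border. $\mathcal{C}^B_{6}$ is the set of all bordered cycles of length $6$ (up to order-preserving isomorphism; there are three of them). *)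

theory Defs
  imports "HOL-Library.Landau_Symbols" "HOL-Library.Disjoint_Sets"
begin

text \<open>The linear order on the vertices is the one inherited from the ambient linearly ordered type.
  Every finite linear order embeds into \<open>nat\<close>, so ordered graphs over \<open>nat\<close> represent all
  ordered graphs up to order-preserving isomorphism.\<close>

record 'a ograph =
  verts :: "'a set"
  edges :: "'a set set"

definition ordered_graph :: "'a::linorder ograph \<Rightarrow> bool" where
  "ordered_graph G \<longleftrightarrow>
     finite (verts G) \<and> edges G \<subseteq> {e. e \<subseteq> verts G \<and> card e = 2}"

text \<open>On a linear order, strictly monotone means injective and order-preserving.\<close>

definition contains_ordered :: "'a::linorder ograph \<Rightarrow> 'b::linorder ograph \<Rightarrow> bool" where
  "contains_ordered G H \<longleftrightarrow>
     (\<exists>f. strict_mono_on (verts H) f \<and> f ` verts H \<subseteq> verts G \<and>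
          (\<forall>e\<in>edges H. f ` e \<in> edges G))"

text \<open>The \<open>Max\<close> is over a finite set; it is nonempty as soon as every graph in \<open>\<H>\<close>
  has an edge (see \<open>ex_ord_candidates\<close> below).\<close>

definition ex_ord :: "nat \<Rightarrow> nat ograph set \<Rightarrow> nat" where
  "ex_ord n \<H> = Max {card (edges G) | G :: nat ograph.
     ordered_graph G \<and> card (verts G) = n \<and> (\<forall>H\<in>\<H>. \<not> contains_ordered G H)}"

text \<open>Intervals are taken relative to the vertex set, not to the ambient type.\<close>

definition interval_of :: "'a::linorder set \<Rightarrow> 'a set \<Rightarrow> bool" where
  "interval_of V I \<longleftrightarrow> I \<subseteq> V \<and> (\<forall>x\<in>I. \<forall>z\<in>I. \<forall>y\<in>V. x \<le> y \<and> y \<le> z \<longrightarrow> y \<in> I)"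

definition interval_colouring :: "'a::linorder ograph \<Rightarrow> 'a set set \<Rightarrow> bool" where
  "interval_colouring G P \<longleftrightarrow> partition_on (verts G) P \<and>
     (\<forall>I\<in>P. interval_of (verts G) I \<and> (\<forall>x\<in>I. \<forall>y\<in>I. {x, y} \<notin> edges G))"

definition interval_chromatic_number :: "'a::linorder ograph \<Rightarrow> nat" where
  "interval_chromatic_number G = (LEAST k. \<exists>P. interval_colouring G P \<and> card P = k)"

definition ordered_cycle :: "'a::linorder ograph \<Rightarrow> bool" where
  "ordered_cycle G \<longleftrightarrow>
     (\<exists>vs. distinct vs \<and> length vs \<ge> 3 \<and> verts G = set vs \<and>
           edges G = {{vs ! i, vs ! (Suc i mod length vs)} | i. i < length vs})"

text \<open>In a graph without isolated vertices, such as a cycle, a colouring by two intervals is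
  unique, so that the quantifier over \<open>U\<close> and \<open>W\<close> involves no choice.\<close>

definition bordered_cycle :: "'a::linorder ograph \<Rightarrow> bool" where
  "bordered_cycle G \<longleftrightarrow> ordered_cycle G \<and> interval_chromatic_number G = 2 \<and>
     (\<exists>U W. interval_colouring G {U, W} \<and> (\<forall>u\<in>U. \<forall>w\<in>W. u < w) \<and>
            {Min U, Max W} \<in> edges G \<and> {Max U, Min W} \<in> edges G)"

text \<open>Fixing the vertex set selects exactly one representative of each class of bordered
  \<open>k\<close>-cycles up to order-preserving isomorphism.\<close>

definition bordered_cycles :: "nat \<Rightarrow> nat ograph set" where
  "bordered_cycles k = {G. verts G = {..<k} \<and> bordered_cycle G}"

lemma ex_ord_candidates:
  fixes \<H> :: "nat ograph set"
  defines "S n \<equiv> {card (edges G) | G :: nat ograph.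
     ordered_graph G \<and> card (verts G) = n \<and> (\<forall>H\<in>\<H>. \<not> contains_ordered G H)}"
  shows "finite (S n)" and "(\<And>H. H \<in> \<H> \<Longrightarrow> edges H \<noteq> {}) \<Longrightarrow> S n \<noteq> {}"
proof -
  have "card (edges G) \<le> 2 ^ n" if "ordered_graph G" "card (verts G) = n" for G :: "nat ograph"
  proof -
    have "edges G \<subseteq> Pow (verts G)" "finite (verts G)"
      using that by (auto simp: ordered_graph_def)
    then show ?thesis
      using that(2) card_mono[of "Pow (verts G)" "edges G"] by (simp add: card_Pow)
  qed
  then have "S n \<subseteq> {..2 ^ n}"
    by (auto simp: S_def)
  then show "finite (S n)"
    by (rule finite_subset) simp
next
  assume ne: "\<And>H. H \<in> \<H> \<Longrightarrow> edges H \<noteq> {}"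
  let ?G = "\<lparr>verts = {..<n}, edges = {}\<rparr>"
  have "ordered_graph ?G" "card (verts ?G) = n" "\<forall>H\<in>\<H>. \<not> contains_ordered ?G H"
    using ne by (auto simp: ordered_graph_def contains_ordered_def)
  then show "S n \<noteq> {}"
    unfolding S_def by blast
qed

end

theory Submission
  imports Defs "HOL-Algebra.Algebraic_Closure_Type" "HOL-Library.Z2"
begin

text \<open>
  Upper bound: regard the edges as the ones of a 0-1 matrix, the smaller endpoint being the row. Count
  paths \<open>x - c - r - y\<close> that start in row \<open>x\<close>, go down column \<open>c\<close> to row \<open>r > x\<close> and then left to
  column \<open>y < c\<close>. Two internally disjoint paths with the same ends \<open>(x, y)\<close> form a bordered
  hexagon, so all paths with given ends share their column \<open>c\<close> or share their row \<open>r\<close>. If three of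
  them share \<open>c\<close>, then \<open>y\<close> and \<open>c\<close> have three common rows, and unless \<open>y\<close> is the first such column
  in row \<open>r\<close>, another bordered hexagon arises. Discarding one \<open>x\<close> and one \<open>y\<close> for each middle
  edge \<open>(r, c)\<close> therefore leaves at most two paths for each pair \<open>(x, y)\<close>. A graph with many edges has
  many middle edges with more than about \<open>n\<^sup>1\<^sup>/\<^sup>3\<close> choices on each side, which is too many paths.

  Lower bound: Wenger's graph over the field with \<open>2\<^sup>k\<close> elements has \<open>2 q\<^sup>3\<close> vertices and
  \<open>q\<^sup>4\<close> edges with \<open>q = 2\<^sup>k\<close>, and no hexagon whatsoever. As \<open>k\<close> ranges over all positive integers, the
  number of vertices grows by a factor of 8, so that constants suffice to reach every \<open>n\<close>.
\<close>

subsection \<open>Matrices without bordered hexagons\<close>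

text \<open>Rows are the smaller endpoints, so the inner border is the bottom left corner \<open>(a3, b1)\<close> and
  the outer border the top right corner \<open>(a1, b3)\<close>; a hexagon is the complement of a perfect matching
  in \<open>K\<^sub>3\<^sub>,\<^sub>3\<close>, and exactly three perfect matchings avoid both corners.\<close>

definition has_bordered_hexagon :: "('a::linorder \<times> 'b::linorder) set \<Rightarrow> bool" where
  "has_bordered_hexagon E \<longleftrightarrow> (\<exists>a1 a2 a3 b1 b2 b3. a1 < a2 \<and> a2 < a3 \<and> b1 < b2 \<and> b2 < b3 \<and>
     (a1, b3) \<in> E \<and> (a3, b1) \<in> E \<and>
     ({(a1, b2), (a2, b1), (a2, b3), (a3, b2)} \<subseteq> E \<or>
      {(a1, b2), (a2, b1), (a2, b2), (a3, b3)} \<subseteq> E \<or>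
      {(a1, b1), (a2, b2), (a2, b3), (a3, b2)} \<subseteq> E))"

lemma has_bordered_hexagonI:
  assumes "a1 < a2" "a2 < a3" "b1 < b2" "b2 < b3" "(a1, b3) \<in> E" "(a3, b1) \<in> E"
    and "{(a1, b2), (a2, b1), (a2, b3), (a3, b2)} \<subseteq> E \<or>
      {(a1, b2), (a2, b1), (a2, b2), (a3, b3)} \<subseteq> E \<or>
      {(a1, b1), (a2, b2), (a2, b3), (a3, b2)} \<subseteq> E"
  shows "has_bordered_hexagon E"
  unfolding has_bordered_hexagon_def by (intro exI conjI) (fact assms)+

text \<open>Transposition swaps the inner with the outer border and maps each of the three patterns
  to itself. It lets results on columns serve for rows.\<close>

lemma has_bordered_hexagon_converse:
  "has_bordered_hexagon (E\<inverse>) \<longleftrightarrow> has_bordered_hexagon E"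
proof -
  have "has_bordered_hexagon (F\<inverse>)" if F: "has_bordered_hexagon F"
    for F :: "('c::linorder \<times> 'd::linorder) set"
  proof -
    from F obtain a1 a2 a3 b1 b2 b3 where h: "a1 < a2" "a2 < a3" "b1 < b2" "b2 < b3"
      "(a1, b3) \<in> F" "(a3, b1) \<in> F"
      "{(a1, b2), (a2, b1), (a2, b3), (a3, b2)} \<subseteq> F \<or>
       {(a1, b2), (a2, b1), (a2, b2), (a3, b3)} \<subseteq> F \<or>
       {(a1, b1), (a2, b2), (a2, b3), (a3, b2)} \<subseteq> F"
      unfolding has_bordered_hexagon_def by (elim exE conjE)
    show ?thesis
      by (rule has_bordered_hexagonI[of b1 b2 b3 a1 a2 a3]) (use h in auto)
  qed
  from this[of E] this[of "E\<inverse>"] show ?thesis by auto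
qed

text \<open>The two paths close up to a hexagon on rows \<open>x, r, r'\<close> and columns
  \<open>y, c, c'\<close>. Its first row \<open>x\<close> meets both later columns and its first
  column \<open>y\<close> meets both later rows, so both corners are edges however
  \<open>r, r'\<close> and \<open>c, c'\<close> are ordered.\<close>

lemma bordered_hexagon_of_disjoint_paths:
  assumes "(x, c) \<in> E" "(r, c) \<in> E" "(r, y) \<in> E" "x < r" "y < c"
    and "(x, c') \<in> E" "(r', c') \<in> E" "(r', y) \<in> E" "x < r'" "y < c'"
    and "r \<noteq> r'" "c \<noteq> c'"
  shows "has_bordered_hexagon E"
proof -
  have *: "has_bordered_hexagon E"
    if h: "(x, c) \<in> E" "(r, c) \<in> E" "(r, y) \<in> E" "x < r" "y < c"
    "(x, c') \<in> E" "(r', c') \<in> E" "(r', y) \<in> E" "x < r'" "y < c'" "r \<noteq> r'" "c < c'" for r r' c c'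
  proof (cases "r < r'")
    case True
    show ?thesis
      by (rule has_bordered_hexagonI[of x r r' y c c']) (use h True in auto)
  next
    case False
    then have "r' < r" using h by auto
    show ?thesis
      by (rule has_bordered_hexagonI[of x r' r y c c']) (use h \<open>r' < r\<close> in auto)
  qed
  show ?thesis
    using *[of c r c' r'] *[of c' r' c r] assms by (metis linorder_neqE)
qed

text \<open>In this hexagon \<open>r\<close> is the only row that misses the last column
  \<open>c\<close>, and \<open>r''\<close> the only one that misses the first column
  \<open>y\<close>. Since \<open>r'' < r\<close>, the first row is not \<open>r\<close> and the last
  row is not \<open>r''\<close>, so both corners are edges wherever \<open>r'\<close> lies.\<close>

lemma bordered_hexagon_of_common_neighbours:
  assumes "(r, y) \<in> E" "(r, y') \<in> E" "(r', y) \<in> E" "(r', c) \<in> E" "(r'', y') \<in> E" "(r'', c) \<in> E"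
    and "y < y'" "y' < c" "r'' < r" "r' \<noteq> r" "r' \<noteq> r''"
  shows "has_bordered_hexagon E"
proof -
  consider "r' < r''" | "r'' < r'" "r' < r" | "r < r'"
    using assms by (metis linorder_neqE)
  then show ?thesis
  proof cases
    case 1 show ?thesis
      by (rule has_bordered_hexagonI[of r' r'' r y y' c]) (use assms 1 in auto)
  next
    case 2 show ?thesis
      by (rule has_bordered_hexagonI[of r'' r' r y y' c]) (use assms 2 in auto)
  next
    case 3 show ?thesis
      by (rule has_bordered_hexagonI[of r'' r r' y y' c]) (use assms 3 in auto)
  qed
qed

section \<open>Paths with given ends\<close>

lemma exists_third_element:
  assumes "3 \<le> card A"
  shows "\<exists>a\<in>A. a \<noteq> u \<and> a \<noteq> v"
proof -
  have "card {u, v} < card A" using assms by (simp add: card_insert_if)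
  then have "\<not> A \<subseteq> {u, v}" by (meson card_mono finite.emptyI finite.insertI leD)
  then show ?thesis by blast
qed

definition left_nbrs :: "('a::linorder \<times> 'b::linorder) set \<Rightarrow> 'a \<times> 'b \<Rightarrow> 'b set" where
  "left_nbrs E = (\<lambda>(r, c). {y. y < c \<and> (r, y) \<in> E})"

text \<open>A column is rich if it shares three rows with \<open>c\<close>. Without a rich left
  neighbour the value is unspecified, which is harmless because it only serves as an element to
  discard.\<close>

definition first_rich_left :: "('a::linorder \<times> 'b::wellorder) set \<Rightarrow> 'a \<times> 'b \<Rightarrow> 'b" where
  "first_rich_left E = (\<lambda>(r, c). LEAST y. y \<in> left_nbrs E (r, c) \<and>
     3 \<le> card {s. (s, y) \<in> E \<and> (s, c) \<in> E})"

text \<open>By transposition, \<open>left_nbrs (E\<inverse>) (c, r)\<close> is the set of neighbours of \<open>c\<close> above \<open>r\<close>.\<close>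

lemma column_star_bound:
  fixes E :: "('a::linorder \<times> 'b::wellorder) set"
  assumes "finite E" "\<not> has_bordered_hexagon E"
    and R: "\<And>r. r \<in> R \<Longrightarrow> (r, c) \<in> E \<and> y \<in> left_nbrs E (r, c) \<and> y \<noteq> first_rich_left E (r, c)"
  shows "finite R" "card R \<le> 2"
proof -
  let ?N = "\<lambda>y. {s. (s, y) \<in> E \<and> (s, c) \<in> E}"
  have "finite (?N y)" for y
    by (rule finite_subset[of _ "fst ` E"]) (use assms(1) in force)+
  moreover have RN: "R \<subseteq> ?N y" using R by (auto simp: left_nbrs_def)
  ultimately show fin: "finite R" by (rule finite_subset[rotated])
  show "card R \<le> 2"
  proof (rule ccontr)
    assume "\<not> card R \<le> 2"
    then have R3: "3 \<le> card R" by simp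
    then have rich: "3 \<le> card (?N y)"
      using card_mono[OF \<open>finite (?N y)\<close> RN] by linarith
    have "R \<noteq> {}" using R3 by auto
    obtain r where r: "r \<in> R" "r \<noteq> Min R"
      using exists_third_element[OF R3] by blast
    have "Min R \<in> R" using fin \<open>R \<noteq> {}\<close> by (rule Min_in)
    moreover have "Min R < r" using Min_le[OF fin r(1)] r(2) by (simp add: order.strict_iff_order)
    ultimately have "Min R < r" "Min R \<in> R" by auto
    let ?P = "\<lambda>z. z \<in> left_nbrs E (r, c) \<and> 3 \<le> card (?N z)"
    have y: "?P y" "y \<noteq> (LEAST z. ?P z)"
      using R[OF r(1)] rich by (auto simp: first_rich_left_def)
    \<comment> \<open>As \<open>y\<close> is rich but not the first rich column in row
      \<open>r\<close>, that row has a rich column \<open>z < y\<close>.\<close>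
    then obtain z where z: "?P z" "z < y"
      by (metis (mono_tags, lifting) LeastI Least_le le_neq_trans)
    \<comment> \<open>Richness asks for three common rows so that one of them avoids both
      \<open>r\<close> and \<open>Min R\<close>.\<close>
    obtain r' where r': "r' \<in> ?N z" "r' \<noteq> r" "r' \<noteq> Min R"
      using exists_third_element z(1) by meson
    have "has_bordered_hexagon E"
      by (rule bordered_hexagon_of_common_neighbours[of r z E y r' c "Min R"])
        (use z y r r' RN R[OF r(1)] \<open>Min R < r\<close> \<open>Min R \<in> R\<close> in \<open>auto simp: left_nbrs_def\<close>)
    with assms(2) show False ..
  qed
qed

text \<open>Pairwise intersecting edges form a star or a triangle, and a bipartite graph has no
  triangle.\<close>

lemma pairwise_meeting_pairs:
  assumes "\<And>p q. p \<in> Q \<Longrightarrow> q \<in> Q \<Longrightarrow> fst p = fst q \<or> snd p = snd q"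
  shows "(\<exists>a. \<forall>p\<in>Q. fst p = a) \<or> (\<exists>b. \<forall>p\<in>Q. snd p = b)"
  using assms by metis

text \<open>A path is determined by its ends and its middle edge \<open>(r, c)\<close>, so
  \<open>Q x y\<close> stands for the paths that survive the discarding. Their middle edges meet
  pairwise and hence form a star.\<close>

lemma card_paths_le_2:
  fixes E :: "('a::wellorder \<times> 'b::wellorder) set"
  assumes fin: "finite E" and free: "\<not> has_bordered_hexagon E"
  defines "Q x y \<equiv> {(r, c). (r, c) \<in> E \<and>
     x \<in> left_nbrs (E\<inverse>) (c, r) - {first_rich_left (E\<inverse>) (c, r)} \<and>
     y \<in> left_nbrs E (r, c) - {first_rich_left E (r, c)}}"
  shows "finite (Q x y)" "card (Q x y) \<le> 2"
proof -
  show finQ: "finite (Q x y)"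
    by (rule finite_subset[OF _ fin]) (auto simp: Q_def)
  have "fst p = fst q \<or> snd p = snd q" if pq: "p \<in> Q x y" "q \<in> Q x y" for p q
  proof (rule ccontr)
    assume "\<not> (fst p = fst q \<or> snd p = snd q)"
    then have "has_bordered_hexagon E"
      using pq by (intro bordered_hexagon_of_disjoint_paths[of x "snd p" E "fst p" y "snd q" "fst q"])
        (auto simp: Q_def left_nbrs_def)
    with free show False ..
  qed
  then consider (row) a where "\<And>p. p \<in> Q x y \<Longrightarrow> fst p = a"
    | (col) b where "\<And>p. p \<in> Q x y \<Longrightarrow> snd p = b"
    using pairwise_meeting_pairs[of "Q x y"] by blast
  then show "card (Q x y) \<le> 2"
  proof cases
    case col
    have "card (Q x y) = card (fst ` Q x y)"
      by (rule card_image[symmetric], rule inj_onI) (use col in \<open>auto simp: prod_eq_iff\<close>)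
    also have "\<dots> \<le> 2"
      by (rule column_star_bound[OF fin free, of _ b y]) (use col in \<open>force simp: Q_def\<close>)
    finally show ?thesis .
  next
    case row
    have "card (Q x y) = card (snd ` Q x y)"
      by (rule card_image[symmetric], rule inj_onI) (use row in \<open>auto simp: prod_eq_iff\<close>)
    \<comment> \<open>A star centred at row \<open>a\<close> is a column star of the transpose, with
      \<open>x\<close> in the role of \<open>y\<close>.\<close>
    also have "\<dots> \<le> 2"
      by (rule column_star_bound[of "E\<inverse>" _ a x])
        (use fin free row in \<open>force simp: Q_def has_bordered_hexagon_converse\<close>)+
    finally show ?thesis .
  qed
qed

section \<open>Counting paths by middle edge and by ends\<close>

lemma card_few_predecessors:
  fixes S :: "'a::linorder set"
  assumes "finite S"
  shows "card {s \<in> S. card {t \<in> S. t < s} \<le> k} \<le> Suc k"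
proof -
  have "inj_on (\<lambda>s. card {t \<in> S. t < s}) S"
  proof (rule linorder_inj_onI')
    fix i j assume "i \<in> S" "j \<in> S" "i < j"
    then have "{t \<in> S. t < i} \<subset> {t \<in> S. t < j}" by auto
    then have "card {t \<in> S. t < i} < card {t \<in> S. t < j}"
      by (rule psubset_card_mono[rotated]) (use assms in simp)
    then show "card {t \<in> S. t < i} \<noteq> card {t \<in> S. t < j}" by simp
  qed
  then have "inj_on (\<lambda>s. card {t \<in> S. t < s}) {s \<in> S. card {t \<in> S. t < s} \<le> k}"
    by (rule inj_on_subset) auto
  then have "card {s \<in> S. card {t \<in> S. t < s} \<le> k} \<le> card {..k}"
    by (rule card_inj_on_le) auto
  then show ?thesis by simp
qed

text \<open>Within a row, the left neighbours of an edge are the predecessors of its column among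
  the neighbours of the row, so each row contains at most \<open>Suc k\<close> such edges.\<close>

lemma card_few_left_nbrs:
  fixes E :: "('a::linorder \<times> 'b::linorder) set"
  assumes "finite A" "E \<subseteq> A \<times> B" "finite B"
  shows "card {e \<in> E. card (left_nbrs E e) \<le> k} \<le> Suc k * card A"
proof -
  let ?S = "\<lambda>r. {c. (r, c) \<in> E}"
  have fin: "finite (?S r)" for r
    by (rule finite_subset[OF _ assms(3)]) (use assms(2) in auto)
  have "{e \<in> E. card (left_nbrs E e) \<le> k} \<subseteq> (SIGMA r:A. {c \<in> ?S r. card {t \<in> ?S r. t < c} \<le> k})"
    using assms(2) by (auto simp: left_nbrs_def conj_commute)
  then have "card {e \<in> E. card (left_nbrs E e) \<le> k} \<le>
      card (SIGMA r:A. {c \<in> ?S r. card {t \<in> ?S r. t < c} \<le> k})"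
    by (rule card_mono[rotated]) (use assms(1) fin in auto)
  also have "\<dots> = (\<Sum>r\<in>A. card {c \<in> ?S r. card {t \<in> ?S r. t < c} \<le> k})"
    using assms(1) fin by (intro card_SigmaI) auto
  also have "\<dots> \<le> (\<Sum>r\<in>A. Suc k)"
    by (intro sum_mono card_few_predecessors fin)
  finally show ?thesis by (simp add: mult.commute)
qed

text \<open>Deleting the edges with at most \<open>k\<close> neighbours on the left or above costs
  at most \<open>Suc k\<close> per row and per column. Each remaining edge is the middle of at least
  \<open>k\<^sup>2\<close> surviving paths. The parameter \<open>k\<close> stays free to be
  optimised later.\<close>

lemma bordered_hexagon_free_bound:
  fixes E :: "('a::wellorder \<times> 'b::wellorder) set"
  assumes "finite A" "finite B" "E \<subseteq> A \<times> B" and free: "\<not> has_bordered_hexagon E"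
  shows "k\<^sup>2 * card E \<le> 2 * card A * card B + k\<^sup>2 * Suc k * (card A + card B)"
proof -
  have fin: "finite E" by (rule finite_subset[OF assms(3)]) (use assms in auto)
  define few_left where "few_left = {e \<in> E. card (left_nbrs E e) \<le> k}"
  define few_up where "few_up = {e \<in> E\<inverse>. card (left_nbrs (E\<inverse>) e) \<le> k}"
  define E' where "E' = E - few_left - few_up\<inverse>"
  define Xs where "Xs = (\<lambda>(r, c). left_nbrs (E\<inverse>) (c, r) - {first_rich_left (E\<inverse>) (c, r)})"
  define Ys where "Ys e = left_nbrs E e - {first_rich_left E e}" for e
  have finE': "finite E'" using fin by (simp add: E'_def)
  have Xs: "Xs e \<subseteq> A" and Ys: "Ys e \<subseteq> B" for e
    using assms(3) by (auto simp: Xs_def Ys_def left_nbrs_def split: prod.splits)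
  have fin_XY: "finite (Xs e \<times> Ys e)" for e
    using finite_subset[OF Xs assms(1)] finite_subset[OF Ys assms(2)] by simp
  have k_Xs: "k \<le> card (Xs e)" and k_Ys: "k \<le> card (Ys e)" if "e \<in> E'" for e
  proof -
    obtain r c where e: "e = (r, c)" by fastforce
    \<comment> \<open>The strict threshold pays for the one discarded neighbour.\<close>
    have *: "k \<le> card (S - {s})" if "k < card S" for S :: "'c set" and s
      using that diff_card_le_card_Diff[of "{s}" S] by simp
    show "k \<le> card (Xs e)"
      unfolding Xs_def e prod.case
      by (rule *) (use that in \<open>auto simp: E'_def few_up_def e\<close>)
    show "k \<le> card (Ys e)"
      unfolding Ys_def e
      by (rule *) (use that in \<open>auto simp: E'_def few_left_def e\<close>)
  qed
  have "k\<^sup>2 * card E' = (\<Sum>e\<in>E'. k * k)"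
    by (simp add: power2_eq_square)
  also have "\<dots> \<le> (\<Sum>e\<in>E'. card (Xs e \<times> Ys e))"
    unfolding card_cartesian_product by (intro sum_mono mult_mono k_Xs k_Ys) auto
  also have "\<dots> = card (SIGMA e:E'. Xs e \<times> Ys e)"
    by (intro card_SigmaI[symmetric] finE' ballI fin_XY)
  \<comment> \<open>From here the paths are grouped by their ends instead of by their middle
    edge.\<close>
  also have "\<dots> \<le> card (SIGMA p:A \<times> B. {e \<in> E'. p \<in> Xs e \<times> Ys e})"
  proof (rule card_inj_on_le[of prod.swap])
    show "prod.swap ` (SIGMA e:E'. Xs e \<times> Ys e) \<subseteq> (SIGMA p:A \<times> B. {e \<in> E'. p \<in> Xs e \<times> Ys e})"
      using Xs Ys by fastforce
    show "finite (SIGMA p:A \<times> B. {e \<in> E'. p \<in> Xs e \<times> Ys e})"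
      using assms(1,2) finE' by (intro finite_SigmaI) auto
  qed simp
  also have "\<dots> = (\<Sum>p\<in>A \<times> B. card {e \<in> E'. p \<in> Xs e \<times> Ys e})"
    using assms(1,2) finE' by (intro card_SigmaI) auto
  also have "\<dots> \<le> (\<Sum>p\<in>A \<times> B. 2)"
  proof (rule sum_mono)
    fix p :: "'a \<times> 'b"
    obtain x y where p: "p = (x, y)" by fastforce
    note Q = card_paths_le_2[OF fin free, of x y]
    have "{e \<in> E'. p \<in> Xs e \<times> Ys e} \<subseteq> {(r, c). (r, c) \<in> E \<and>
     x \<in> left_nbrs (E\<inverse>) (c, r) - {first_rich_left (E\<inverse>) (c, r)} \<and>
     y \<in> left_nbrs E (r, c) - {first_rich_left E (r, c)}}"
      unfolding p Xs_def Ys_def E'_def by auto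
    from card_mono[OF Q(1) this] Q(2) show "card {e \<in> E'. p \<in> Xs e \<times> Ys e} \<le> 2"
      by linarith
  qed
  finally have paths: "k\<^sup>2 * card E' \<le> 2 * card A * card B"
    by (simp add: card_cartesian_product mult_ac)
  have "E \<subseteq> E' \<union> (few_left \<union> few_up\<inverse>)" by (auto simp: E'_def)
  then have "card E \<le> card (E' \<union> (few_left \<union> few_up\<inverse>))"
    using finE' fin by (intro card_mono) (auto simp: few_left_def few_up_def)
  also have "\<dots> \<le> card E' + (card (few_left) + card (few_up\<inverse>))"
    using card_Un_le[of E'] card_Un_le[of "few_left"] by (meson add_left_mono order_trans)
  also have "\<dots> \<le> card E' + (Suc k * card A + Suc k * card B)"
    unfolding card_inverse few_left_def few_up_def using assms
    by (intro add_left_mono add_mono card_few_left_nbrs[of _ _ B] card_few_left_nbrs[of _ _ A]) auto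
  finally have "k\<^sup>2 * card E \<le> k\<^sup>2 * (card E' + Suc k * (card A + card B))"
    by (intro mult_left_mono) (simp_all add: algebra_simps)
  with paths show ?thesis by (simp add: algebra_simps)
qed

subsection \<open>The Wenger graph over a field of order a power of two\<close>

text \<open>The fixed points are the roots of \<open>X^q - X\<close>. This polynomial splits into
  linear factors, and its derivative is \<open>-1\<close> because the characteristic divides
  \<open>q\<close>, so a repeated root is impossible.\<close>

lemma card_fixpoints_frobenius_power:
  fixes q k :: nat
  assumes "CHAR('a::alg_closed_field) > 1" "q = CHAR('a) ^ k" "k > 0"
  shows "finite {x::'a. x ^ q = x}" "card {x::'a. x ^ q = x} = q"
proof -
  define p :: "'a poly" where "p = monom 1 q - monom 1 1"
  have "q > 1" using assms using one_less_power[of "CHAR('a)" k] by simp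
  have "CHAR('a) dvd q" using assms by simp
  then have [simp]: "of_nat q = (0::'a)"
    by (simp only: of_nat_eq_0_iff_char_dvd)
  have deg: "degree p = q" and lc: "lead_coeff p = 1"
  proof -
    have "degree p = degree (monom (1::'a) q)"
      unfolding p_def diff_conv_add_uminus
      by (rule degree_add_eq_left) (use \<open>q > 1\<close> in \<open>simp add: degree_monom_eq\<close>)
    then show "degree p = q" by (simp add: degree_monom_eq)
    then show "lead_coeff p = 1" using \<open>q > 1\<close> by (simp add: p_def)
  qed
  then have "p \<noteq> 0" by auto
  then obtain A where A: "size A = q" "p = (\<Prod>x\<in>#A. [:-x, 1:])"
    using alg_closed_imp_factorization[of p] deg lc by auto
  have roots: "set_mset A = {x. x ^ q = x}"
  proof -
    have "x \<in># A \<longleftrightarrow> poly p x = 0" for x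
      unfolding A(2) by (auto simp: poly_prod_mset prod_mset_zero_iff)
    then show ?thesis by (auto simp: p_def poly_monom)
  qed
  have "count A x \<le> 1" for x
  proof (rule ccontr)
    assume "\<not> count A x \<le> 1"
    then have "{#x, x#} \<subseteq># A" by (simp add: subseteq_mset_def)
    then obtain B where "A = add_mset x (add_mset x B)" by (auto simp: subset_mset.le_iff_add)
    then obtain L R where "p = L * (L * R)" "poly L x = 0"
      using A(2) by (intro that[of "[:-x, 1:]" "\<Prod>x\<in>#B. [:-x, 1:]"]) simp_all
    then have "poly (pderiv p) x = 0" by (simp add: pderiv_mult)
    moreover have "poly (pderiv p) x = -1"
      by (simp add: p_def pderiv_diff pderiv_monom poly_monom)
    ultimately show False by simp
  qed
  then have "count A x = 1" if "x \<in># A" for x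
    using that by (simp add: antisym Suc_leI)
  then have "size A = card (set_mset A)"
    by (simp add: size_multiset_overloaded_eq)
  then show "card {x::'a. x ^ q = x} = q" "finite {x::'a. x ^ q = x}"
    unfolding roots[symmetric] using A(1) by simp_all
qed

text \<open>This is the field with \<open>2 ^ k\<close> elements, realised as the fixed points of an
  iterated Frobenius map. In characteristic two differences are sums, so the freshman's dream covers
  them.\<close>

lemma finite_subring_of_order_two_power:
  assumes "k > 0"
  obtains F :: "bit alg_closure set" where "finite F" "card F = 2 ^ k"
    "\<And>x y. x \<in> F \<Longrightarrow> y \<in> F \<Longrightarrow> x * y \<in> F" "\<And>x y. x \<in> F \<Longrightarrow> y \<in> F \<Longrightarrow> x - y \<in> F"
proof -
  have "CHAR(bit) = 2"
  proof (rule CHAR_eqI)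
    show "2 dvd n" if "of_nat n = (0::bit)" for n
      using that by (cases "even n") (auto elim!: oddE)
  qed simp
  then have char: "CHAR(bit alg_closure) = 2" by simp
  let ?F = "{x::bit alg_closure. x ^ 2 ^ k = x}"
  have neg: "- x = x" for x :: "bit alg_closure"
  proof -
    have "(2::bit alg_closure) = 0"
      using of_nat_CHAR[where 'a = "bit alg_closure"] unfolding char by simp
    then have "x + x = 0" by (simp flip: mult_2)
    then show ?thesis by (rule minus_unique)
  qed
  show ?thesis
  proof (rule that[of ?F])
    show "finite ?F" "card ?F = 2 ^ k"
      using card_fixpoints_frobenius_power[where 'a = "bit alg_closure" and k = k] assms char by auto
    show "x * y \<in> ?F" if "x \<in> ?F" "y \<in> ?F" for x y
      using that by (simp add: power_mult_distrib)
    show "x - y \<in> ?F" if "x \<in> ?F" "y \<in> ?F" for x y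
      using that freshmans_dream'[of "2 ^ k" k x y] neg[of y] char
      by (simp only: diff_conv_add_uminus) simp
  qed
qed

text \<open>The points \<open>(a, b, c)\<close> incident with \<open>(x, y, z)\<close> lie on an
  affine line of direction \<open>(1, x, x\<^sup>2)\<close>. Confining the coordinates to a subset
  \<open>F\<close> allows working inside an infinite field.\<close>

definition wenger_incidence :: "'a::field set \<Rightarrow> (('a \<times> 'a \<times> 'a) \<times> ('a \<times> 'a \<times> 'a)) set" where
  "wenger_incidence F = {((a, b, c), (x, y, z)) | a b c x y z.
     {a, b, c, x, y, z} \<subseteq> F \<and> b + y = a * x \<and> c + z = a * x\<^sup>2}"

definition has_hexagon :: "('a \<times> 'b) set \<Rightarrow> bool" where
  "has_hexagon I \<longleftrightarrow> (\<exists>p1 p2 p3 l1 l2 l3. distinct [p1, p2, p3] \<and> distinct [l1, l2, l3] \<and>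
     {(p1, l1), (p2, l1), (p2, l2), (p3, l2), (p3, l3), (p1, l3)} \<subseteq> I)"

text \<open>A hexagon would give a nontrivial linear relation among the vectors \<open>(1, x, x\<^sup>2)\<close> for the
  three distinct first coordinates \<open>x\<close> of its lines.\<close>

lemma wenger_no_hexagon: "\<not> has_hexagon (wenger_incidence F)"
proof
  assume "has_hexagon (wenger_incidence F)"
  then obtain p1 p2 p3 l1 l2 l3 where *: "distinct [p1, p2, p3]" "distinct [l1, l2, l3]"
    "{(p1, l1), (p2, l1), (p2, l2), (p3, l2), (p3, l3), (p1, l3)} \<subseteq> wenger_incidence F"
    unfolding has_hexagon_def by (elim exE conjE)
  obtain a1 b1 c1 a2 b2 c2 a3 b3 c3 where p: "p1 = (a1, b1, c1)" "p2 = (a2, b2, c2)" "p3 = (a3, b3, c3)"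
    using prod_cases3 by metis
  obtain x1 y1 z1 x2 y2 z2 x3 y3 z3 where l: "l1 = (x1, y1, z1)" "l2 = (x2, y2, z2)" "l3 = (x3, y3, z3)"
    using prod_cases3 by metis
  from * have dist: "(a1, b1, c1) \<noteq> (a2, b2, c2)" "(x1, y1, z1) \<noteq> (x2, y2, z2)"
    "(x1, y1, z1) \<noteq> (x3, y3, z3)"
    by (simp_all add: p l)
  from *(3) have lin: "b1 + y1 = a1 * x1" "b2 + y1 = a2 * x1" "b2 + y2 = a2 * x2"
      "b3 + y2 = a3 * x2" "b3 + y3 = a3 * x3" "b1 + y3 = a1 * x3"
    and quad: "c1 + z1 = a1 * x1\<^sup>2" "c2 + z1 = a2 * x1\<^sup>2" "c2 + z2 = a2 * x2\<^sup>2"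
      "c3 + z2 = a3 * x2\<^sup>2" "c3 + z3 = a3 * x3\<^sup>2" "c1 + z3 = a1 * x3\<^sup>2"
    by (simp_all add: p l wenger_incidence_def)
  \<comment> \<open>Two points on a common line agree once their first coordinates do, and likewise
    two lines through a common point.\<close>
  have "a1 \<noteq> a2"
  proof
    assume "a1 = a2"
    then have "b1 + y1 = b2 + y1" "c1 + z1 = c2 + z1" using lin quad by simp_all
    with \<open>a1 = a2\<close> dist(1) show False by simp
  qed
  have "x1 \<noteq> x2"
  proof
    assume "x1 = x2"
    then have "b2 + y1 = b2 + y2" "c2 + z1 = c2 + z2" using lin quad by simp_all
    with \<open>x1 = x2\<close> dist(2) show False by simp
  qed
  have "x1 \<noteq> x3"
  proof
    assume "x1 = x3"
    then have "b1 + y1 = b1 + y3" "c1 + z1 = c1 + z3" using lin quad by simp_all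
    with \<open>x1 = x3\<close> dist(3) show False by simp
  qed
  \<comment> \<open>Around the hexagon the differences of each point coordinate telescope to zero,
    which gives three relations.\<close>
  define d1 d2 d3 where d: "d1 = a1 - a2" "d2 = a2 - a3" "d3 = a3 - a1"
  have 0: "d1 + d2 + d3 = 0" by (simp add: d)
  have "d1 * x1 = b1 - b2" "d2 * x2 = b2 - b3" "d3 * x3 = b3 - b1"
    by (simp_all add: d left_diff_distrib flip: lin)
  then have 1: "d1 * x1 + d2 * x2 + d3 * x3 = 0" by simp
  have "d1 * x1\<^sup>2 = c1 - c2" "d2 * x2\<^sup>2 = c2 - c3" "d3 * x3\<^sup>2 = c3 - c1"
    by (simp_all add: d left_diff_distrib flip: quad)
  then have 2: "d1 * x1\<^sup>2 + d2 * x2\<^sup>2 + d3 * x3\<^sup>2 = 0" by simp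
  \<comment> \<open>The coefficients of \<open>(T - x2) * (T - x3)\<close> combine the relations so
    that only the term of \<open>x1\<close> survives.\<close>
  have "d1 * ((x1 - x2) * (x1 - x3)) = (d1 * x1\<^sup>2 + d2 * x2\<^sup>2 + d3 * x3\<^sup>2)
      - (x2 + x3) * (d1 * x1 + d2 * x2 + d3 * x3) + x2 * x3 * (d1 + d2 + d3)"
    by (simp add: algebra_simps power2_eq_square)
  then have "d1 * ((x1 - x2) * (x1 - x3)) = 0" by (simp only: 0 1 2) simp
  then show False using \<open>x1 \<noteq> x2\<close> \<open>x1 \<noteq> x3\<close> \<open>a1 \<noteq> a2\<close> by (simp add: d)
qed

text \<open>A point and the first coordinate of a line through it determine the line.\<close>

lemma card_wenger_incidence:
  assumes "finite F" "\<And>x y. x \<in> F \<Longrightarrow> y \<in> F \<Longrightarrow> x * y \<in> F"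
    "\<And>x y. x \<in> F \<Longrightarrow> y \<in> F \<Longrightarrow> x - y \<in> F"
  shows "card (wenger_incidence F) = card F ^ 4"
proof -
  let ?f = "\<lambda>(a, b, c, x). ((a, b, c), (x, a * x - b, a * x\<^sup>2 - c))"
  have "wenger_incidence F = ?f ` (F \<times> F \<times> F \<times> F)"
  proof (intro equalityI subsetI)
    fix e assume "e \<in> wenger_incidence F"
    then show "e \<in> ?f ` (F \<times> F \<times> F \<times> F)"
      by (auto simp: wenger_incidence_def image_iff eq_diff_eq add.commute)
  next
    fix e assume "e \<in> ?f ` (F \<times> F \<times> F \<times> F)"
    then show "e \<in> wenger_incidence F"
      by (auto simp: wenger_incidence_def power2_eq_square assms)
  qed
  moreover have "inj_on ?f (F \<times> F \<times> F \<times> F)" by (auto simp: inj_on_def)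
  ultimately show ?thesis by (simp add: card_image card_cartesian_product power4_eq_xxxx)
qed

subsection \<open>Bordered six-cycles in ordered graphs\<close>

definition cycle_graph :: "'a list \<Rightarrow> 'a ograph" where
  "cycle_graph vs = \<lparr>verts = set vs, edges = {{vs ! i, vs ! (Suc i mod length vs)} | i. i < length vs}\<rparr>"

lemma edges_cycle_graph_6:
  "edges (cycle_graph [a, b, c, d, e, f]) = {{a, b}, {b, c}, {c, d}, {d, e}, {e, f}, {f, a}}"
proof -
  have "edges (cycle_graph [a, b, c, d, e, f]) =
      (\<lambda>i. {[a, b, c, d, e, f] ! i, [a, b, c, d, e, f] ! (Suc i mod 6)}) ` {..<6}"
    by (auto simp: cycle_graph_def)
  also have "{..<6::nat} = {0, 1, 2, 3, 4, 5}" by auto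
  finally show ?thesis by simp
qed

text \<open>The two intervals are \<open>{0, 1, 2}\<close> and \<open>{3, 4, 5}\<close>, with
  borders \<open>{0, 5}\<close> and \<open>{2, 3}\<close>. The outer border alone forces at least
  two intervals.\<close>

lemma cycle_graph_in_bordered_cycles:
  fixes vs :: "nat list"
  assumes "distinct vs" "3 \<le> length vs" "set vs = {..<6}"
    and bip: "\<And>e. e \<in> edges (cycle_graph vs) \<Longrightarrow> \<exists>u w. e = {u, w} \<and> u < 3 \<and> 3 \<le> w"
    and border: "{0, 5} \<in> edges (cycle_graph vs)" "{2, 3} \<in> edges (cycle_graph vs)"
  shows "cycle_graph vs \<in> bordered_cycles 6"
proof -
  let ?G = "cycle_graph vs" and ?U = "{..<3::nat}" and ?W = "{3..<6::nat}"
  have V: "verts ?G = {..<6}" using assms(3) by (simp add: cycle_graph_def)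
  have UW: "0 \<in> ?U" "0 \<notin> ?W" "5 \<in> ?W" by auto
  then have ne: "?U \<noteq> ?W" "?U \<noteq> {}" "?W \<noteq> {}" by blast+
  have col: "interval_colouring ?G {?U, ?W}"
    unfolding interval_colouring_def V
  proof (intro conjI ballI)
    show "partition_on {..<6} {?U, ?W}"
      by (rule partition_onI) (use ne in \<open>auto simp: disjnt_def\<close>)
    show "interval_of {..<6} I" if "I \<in> {?U, ?W}" for I
      using that by (auto simp: interval_of_def)
    show "{x, y} \<notin> edges ?G" if "I \<in> {?U, ?W}" "x \<in> I" "y \<in> I" for I x y
      using that bip[of "{x, y}"] by (auto simp: doubleton_eq_iff)
  qed
  have "interval_chromatic_number ?G = 2"
    unfolding interval_chromatic_number_def
  proof (rule Least_equality)
    show "\<exists>P. interval_colouring ?G P \<and> card P = 2"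
      using col ne by (intro exI[of _ "{?U, ?W}"]) simp
  next
    fix k assume "\<exists>P. interval_colouring ?G P \<and> card P = k"
    then obtain P where P: "partition_on {..<6} P" "card P = k"
      "\<And>I x y. I \<in> P \<Longrightarrow> x \<in> I \<Longrightarrow> y \<in> I \<Longrightarrow> {x, y} \<notin> edges ?G"
      unfolding interval_colouring_def V by blast
    have "finite P" using P(1) by (rule finite_elements[rotated]) simp
    have five: "(5::nat) < 6" by simp
    obtain I J where IJ: "I \<in> P" "J \<in> P" "0 \<in> I" "5 \<in> J"
      using partition_onD1[OF P(1)] by (metis UnionE lessThan_iff zero_less_numeral five)
    then have "I \<noteq> J" using P(3) border(1) by blast
    then have "card {I, J} = 2" by simp
    moreover have "card {I, J} \<le> card P" using IJ \<open>finite P\<close> by (intro card_mono) auto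
    ultimately show "2 \<le> k" using P(2) by simp
  qed
  moreover have "Min ?U = 0" "Max ?U = 2" "Min ?W = 3" "Max ?W = 5"
    by (auto intro!: Min_eqI Max_eqI)
  moreover have "\<forall>u\<in>?U. \<forall>w\<in>?W. u < w" by auto
  moreover have "ordered_cycle ?G"
    unfolding ordered_cycle_def using assms(1,2) by (intro exI[of _ vs]) (simp add: cycle_graph_def)
  ultimately have "bordered_cycle ?G"
    unfolding bordered_cycle_def using col border by metis
  with V show ?thesis by (simp add: bordered_cycles_def)
qed

text \<open>The cycles appear in the order of the three patterns in
  \<open>has_bordered_hexagon\<close>, with rows \<open>0, 1, 2\<close> and columns
  \<open>3, 4, 5\<close>.\<close>

lemma bordered_hexagons:
  "cycle_graph [0, 4, 2, 3, 1, 5] \<in> bordered_cycles 6"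
  "cycle_graph [0, 4, 1, 3, 2, 5] \<in> bordered_cycles 6"
  "cycle_graph [0, 3, 2, 4, 1, 5] \<in> bordered_cycles 6"
proof -
  have e: "\<exists>u w. {x, y} = {u, w} \<and> u < 3 \<and> 3 \<le> w" if "x < 3 \<and> 3 \<le> y \<or> y < 3 \<and> 3 \<le> x" for x y :: nat
    using that by (metis insert_commute)
  show "cycle_graph [0, 4, 2, 3, 1, 5] \<in> bordered_cycles 6"
    "cycle_graph [0, 4, 1, 3, 2, 5] \<in> bordered_cycles 6"
    "cycle_graph [0, 3, 2, 4, 1, 5] \<in> bordered_cycles 6"
    by (rule cycle_graph_in_bordered_cycles;
      force simp: edges_cycle_graph_6 insert_commute intro!: e)+
qed

definition up_edges :: "'a::linorder ograph \<Rightarrow> ('a \<times> 'a) set" where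
  "up_edges G = {(a, b). a < b \<and> {a, b} \<in> edges G}"

text \<open>The inner border \<open>(a3, b1)\<close> yields \<open>a3 < b1\<close>, which puts all
  six vertices in increasing order, rows before columns. Listing them in this order is the
  embedding.\<close>

lemma contains_bordered_cycle:
  fixes G :: "nat ograph"
  assumes G: "ordered_graph G" and hex: "has_bordered_hexagon (up_edges G)"
  shows "\<exists>H\<in>bordered_cycles 6. contains_ordered G H"
proof -
  from hex obtain a1 a2 a3 b1 b2 b3 where less: "a1 < a2" "a2 < a3" "b1 < b2" "b2 < b3"
    and E: "(a1, b3) \<in> up_edges G" "(a3, b1) \<in> up_edges G"
      "{(a1, b2), (a2, b1), (a2, b3), (a3, b2)} \<subseteq> up_edges G \<or>
       {(a1, b2), (a2, b1), (a2, b2), (a3, b3)} \<subseteq> up_edges G \<or>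
       {(a1, b1), (a2, b2), (a2, b3), (a3, b2)} \<subseteq> up_edges G"
    unfolding has_bordered_hexagon_def by (elim exE conjE)
  let ?xs = "[a1, a2, a3, b1, b2, b3]"
  have sorted: "sorted_wrt (<) ?xs" using less E by (auto simp: up_edges_def)
  have mono: "strict_mono_on {..<6} ((!) ?xs)"
  proof (rule strict_mono_onI)
    fix i j :: nat assume "i \<in> {..<6}" "j \<in> {..<6}" "i < j"
    then show "?xs ! i < ?xs ! j" by (intro sorted_wrt_nth_less[OF sorted]) simp_all
  qed
  have V: "e \<subseteq> verts G" if "e \<in> edges G" for e
    using G that by (auto simp: ordered_graph_def)
  have "(!) ?xs ` {..<6} = set ?xs" by (auto simp: set_conv_nth)
  moreover have "set ?xs \<subseteq> verts G"
    using E V unfolding up_edges_def by auto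
  ultimately have verts: "(!) ?xs ` {..<6} \<subseteq> verts G" by simp
  have *: "contains_ordered G H"
    if "H \<in> bordered_cycles 6" "\<forall>e\<in>edges H. (!) ?xs ` e \<in> edges G" for H
    unfolding contains_ordered_def using mono verts that
    by (intro exI[of _ "(!) ?xs"]) (simp add: bordered_cycles_def)
  have E': "{a, b} \<in> edges G" "{b, a} \<in> edges G" if "(a, b) \<in> up_edges G" for a b
    using that by (simp_all add: up_edges_def insert_commute)
  from E(3) show ?thesis
  proof (elim disjE)
    assume "{(a1, b2), (a2, b1), (a2, b3), (a3, b2)} \<subseteq> up_edges G"
    then show ?thesis using E(1,2)
      by (intro bexI[OF _ bordered_hexagons(1)] *[OF bordered_hexagons(1)])
        (simp add: edges_cycle_graph_6 E')
  next
    assume "{(a1, b2), (a2, b1), (a2, b2), (a3, b3)} \<subseteq> up_edges G"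
    then show ?thesis using E(1,2)
      by (intro bexI[OF _ bordered_hexagons(2)] *[OF bordered_hexagons(2)])
        (simp add: edges_cycle_graph_6 E')
  next
    assume "{(a1, b1), (a2, b2), (a2, b3), (a3, b2)} \<subseteq> up_edges G"
    then show ?thesis using E(1,2)
      by (intro bexI[OF _ bordered_hexagons(3)] *[OF bordered_hexagons(3)])
        (simp add: edges_cycle_graph_6 E')
  qed
qed

section \<open>Upper bound for the extremal function\<close>

lemma edges_bordered_cycle_nonempty:
  assumes "H \<in> bordered_cycles k"
  shows "edges H \<noteq> {}"
  using assms unfolding bordered_cycles_def bordered_cycle_def by auto

lemma card_edges_le:
  fixes G :: "nat ograph"
  assumes G: "ordered_graph G" "card (verts G) = n"
    and free: "\<forall>H\<in>bordered_cycles 6. \<not> contains_ordered G H"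
  shows "k\<^sup>2 * card (edges G) \<le> 2 * n\<^sup>2 + 2 * k\<^sup>2 * Suc k * n"
proof -
  have fin: "finite (verts G)" and sub: "up_edges G \<subseteq> verts G \<times> verts G"
    using G(1) by (auto simp: ordered_graph_def up_edges_def)
  have "edges G \<subseteq> (\<lambda>(a, b). {a, b}) ` up_edges G"
  proof
    fix e assume e: "e \<in> edges G"
    then have "card e = 2" using G(1) by (auto simp: ordered_graph_def)
    then obtain a b where "e = {a, b}" "a \<noteq> b" by (meson card_2_iff)
    then obtain a b where "e = {a, b}" "a < b"
      by (metis insert_commute linorder_neqE)
    with e show "e \<in> (\<lambda>(a, b). {a, b}) ` up_edges G"
      by (force simp: up_edges_def)
  qed
  then have "card (edges G) \<le> card (up_edges G)"
    by (rule surj_card_le[rotated]) (use fin sub finite_subset in blast)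
  then have "k\<^sup>2 * card (edges G) \<le> k\<^sup>2 * card (up_edges G)" by simp
  also have "\<dots> \<le> 2 * n * n + k\<^sup>2 * Suc k * (n + n)"
    using bordered_hexagon_free_bound[OF fin fin sub, of k] contains_bordered_cycle[OF G(1)] free G(2)
    by auto
  finally show ?thesis by (simp add: power2_eq_square algebra_simps)
qed

lemma ex_ord_bordered_cycles_le:
  "k\<^sup>2 * ex_ord n (bordered_cycles 6) \<le> 2 * n\<^sup>2 + 2 * k\<^sup>2 * Suc k * n"
proof -
  let ?S = "{card (edges G) | G :: nat ograph.
     ordered_graph G \<and> card (verts G) = n \<and> (\<forall>H\<in>bordered_cycles 6. \<not> contains_ordered G H)}"
  have "Max ?S \<in> ?S"
    by (rule Max_in) (use ex_ord_candidates[where \<H> = "bordered_cycles 6"] edges_bordered_cycle_nonempty in blast)+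
  then show ?thesis
    unfolding ex_ord_def using card_edges_le by auto
qed

text \<open>The terms \<open>2 n^2 / k^2\<close> and \<open>2 (k + 1) n\<close> balance for
  \<open>k\<close> near \<open>t = n^(1/3)\<close>. From \<open>t \<le> k \<le> 2 t\<close> and
  \<open>1 \<le> t\<close> they are at most \<open>2 t^4\<close> and \<open>6 t^4\<close>, whence
  the constant 8.\<close>

lemma ex_ord_bordered_cycles_upper:
  assumes "n > 0"
  shows "real (ex_ord n (bordered_cycles 6)) \<le> 8 * real n powr (4 / 3)"
proof -
  let ?e = "real (ex_ord n (bordered_cycles 6))"
  define t where "t = real n powr (1 / 3)"
  have t: "t \<ge> 1" using assms by (simp add: t_def ge_one_powr_ge_zero)
  have t3: "t ^ 3 = real n" and t4: "t ^ 4 = real n powr (4 / 3)"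
    using assms by (simp_all add: t_def powr_power)
  define k where "k = nat \<lceil>t\<rceil>"
  have k: "t \<le> real k" "real k \<le> 2 * t"
    using t by (auto simp: k_def) linarith
  have "real (k\<^sup>2 * ex_ord n (bordered_cycles 6)) \<le> real (2 * n\<^sup>2 + 2 * k\<^sup>2 * Suc k * n)"
    by (intro of_nat_mono ex_ord_bordered_cycles_le)
  then have "(real k)\<^sup>2 * ?e \<le> 2 * (t ^ 3)\<^sup>2 + 2 * (real k)\<^sup>2 * (1 + real k) * t ^ 3"
    unfolding t3 by (simp add: algebra_simps)
  also have "\<dots> = 2 * t\<^sup>2 * t ^ 4 + (real k)\<^sup>2 * (2 * (1 + real k) * t ^ 3)"
    by (simp add: algebra_simps power_add[symmetric] power_mult[symmetric])
  also have "\<dots> \<le> 2 * (real k)\<^sup>2 * t ^ 4 + (real k)\<^sup>2 * (2 * (3 * t) * t ^ 3)"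
    using t k by (intro add_mono mult_mono power_mono) auto
  also have "\<dots> = (real k)\<^sup>2 * (8 * t ^ 4)"
    by (simp add: algebra_simps power_add[symmetric] eval_nat_numeral)
  finally have "?e \<le> 8 * t ^ 4"
    using t k by (simp add: mult_le_cancel_left_pos)
  then show ?thesis by (simp add: t4)
qed

section \<open>Lower bound for the extremal function\<close>

text \<open>All points precede all lines, but the order is irrelevant: the graph contains no cycle of
  length six at all.\<close>

lemma card_hexagon_free_le_ex_ord:
  assumes fin: "finite P" "finite L" and I: "I \<subseteq> P \<times> L" "\<not> has_hexagon I"
    and n: "card P + card L \<le> n"
  shows "card I \<le> ex_ord n (bordered_cycles 6)"
proof -
  define m where "m = card P"
  obtain g where g: "bij_betw g P {0..<m}"
    using ex_bij_betw_finite_nat[OF fin(1)] unfolding m_def by blast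
  obtain h0 where h0: "bij_betw h0 L {0..<card L}"
    using ex_bij_betw_finite_nat[OF fin(2)] by blast
  \<comment> \<open>Lines are numbered after the \<open>m\<close> points; vertices from
    \<open>card P + card L\<close> on stay isolated.\<close>
  define h where "h l = m + h0 l" for l
  have g_less: "g p < m" if "p \<in> P" for p
    using g that by (auto simp: bij_betw_def)
  have h_less: "h l < n" if "l \<in> L" for l
  proof -
    have "h0 l \<in> {0..<card L}" using h0 that by (auto simp: bij_betw_def)
    then show ?thesis using n by (simp add: h_def m_def)
  qed
  have inj_g: "inj_on g P" and inj_h: "inj_on h L"
    using g h0 by (auto simp: bij_betw_def h_def inj_on_def)
  define E where "E = (\<lambda>(p, l). {g p, h l}) ` I"
  define G where "G = \<lparr>verts = {..<n}, edges = E\<rparr>"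
  define a b where "a = inv_into P g" "b = inv_into L h"
  have adj: "\<not> v < m \<and> g (a u) = u \<and> h (b v) = v \<and> (a u, b v) \<in> I" if "{u, v} \<in> E" "u < m" for u v
  proof -
    from that obtain p l where pl: "(p, l) \<in> I" "u = g p" "v = h l"
      by (auto simp: E_def doubleton_eq_iff h_def)
    then have "a u = p" "b v = l"
      using I(1) inj_g inj_h by (auto simp: a_b_def)
    moreover have "\<not> v < m" by (simp add: pl h_def)
    ultimately show ?thesis using pl by simp
  qed
  have bip: "u < m \<longleftrightarrow> \<not> v < m" if "{u, v} \<in> E" for u v
  proof -
    from that obtain p l where "p \<in> P" "{u, v} = {g p, h l}" using I(1) by (auto simp: E_def)
    then show ?thesis using g_less[of p] by (auto simp: doubleton_eq_iff h_def)
  qed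
  have hex: False
    if "u1 < m" and dist: "distinct [u1, v1, u2, v2, u3, v3]"
      and E: "{u1, v1} \<in> E" "{v1, u2} \<in> E" "{u2, v2} \<in> E" "{v2, u3} \<in> E" "{u3, v3} \<in> E" "{v3, u1} \<in> E"
    for u1 v1 u2 v2 u3 v3
  proof -
    have less: "u2 < m" "u3 < m" using bip E \<open>u1 < m\<close> by blast+
    have E': "{u2, v1} \<in> E" "{u3, v2} \<in> E" "{u1, v3} \<in> E"
      using E by (simp_all add: insert_commute)
    note A = adj[OF E(1) \<open>u1 < m\<close>] adj[OF E'(1) less(1)] adj[OF E(3) less(1)]
      adj[OF E'(2) less(2)] adj[OF E(5) less(2)] adj[OF E'(3) \<open>u1 < m\<close>]
    have "distinct [a u1, a u2, a u3]" "distinct [b v1, b v2, b v3]"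
    proof -
      have "distinct (map g [a u1, a u2, a u3])" "distinct (map h [b v1, b v2, b v3])"
        using A dist by simp_all
      then show "distinct [a u1, a u2, a u3]" "distinct [b v1, b v2, b v3]"
        unfolding distinct_map by simp_all
    qed
    then have "has_hexagon I"
      unfolding has_hexagon_def using A
      by (intro exI[of _ "a u1"] exI[of _ "a u2"] exI[of _ "a u3"]
          exI[of _ "b v1"] exI[of _ "b v2"] exI[of _ "b v3"]) simp
    with I(2) show False ..
  qed
  have "\<not> contains_ordered G H" if H: "H \<in> bordered_cycles 6" for H
  proof
    assume "contains_ordered G H"
    then obtain f where f: "strict_mono_on (verts H) f" "\<And>e. e \<in> edges H \<Longrightarrow> f ` e \<in> E"
      by (auto simp: contains_ordered_def G_def)
    from H obtain vs where vs: "distinct vs" "set vs = {..<6}" "H = cycle_graph vs"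
      unfolding bordered_cycles_def bordered_cycle_def ordered_cycle_def cycle_graph_def by auto
    then have "length vs = 6" using distinct_card by fastforce
    then obtain v1 v2 v3 v4 v5 v6 where v: "vs = [v1, v2, v3, v4, v5, v6]"
      by (auto simp: eval_nat_numeral length_Suc_conv)
    have "inj_on f (set vs)"
      using f(1) vs by (auto simp: cycle_graph_def intro: strict_mono_on_imp_inj_on)
    then have "distinct (map f vs)" using vs(1) by (simp add: distinct_map)
    then have d: "distinct [f v1, f v2, f v3, f v4, f v5, f v6]"
      "distinct [f v2, f v3, f v4, f v5, f v6, f v1]" by (auto simp: v)
    have E: "{f v1, f v2} \<in> E" "{f v2, f v3} \<in> E" "{f v3, f v4} \<in> E"
      "{f v4, f v5} \<in> E" "{f v5, f v6} \<in> E" "{f v6, f v1} \<in> E"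
      using f(2)[of "{v1, v2}"] f(2)[of "{v2, v3}"] f(2)[of "{v3, v4}"] f(2)[of "{v4, v5}"]
        f(2)[of "{v5, v6}"] f(2)[of "{v6, v1}"]
      by (simp_all add: vs(3) v edges_cycle_graph_6)
    \<comment> \<open>Points and lines alternate along the cycle, so it is read from
      \<open>f v1\<close> or from \<open>f v2\<close>, whichever is a point.\<close>
    show False
      using hex[OF _ d(1) E] hex[OF _ d(2) E(2-6,1)] bip[OF E(1)] by blast
  qed
  moreover have "ordered_graph G"
  proof -
    have "e \<subseteq> {..<n} \<and> card e = 2" if "e \<in> E" for e
    proof -
      from that obtain p l where pl: "p \<in> P" "l \<in> L" "e = {g p, h l}"
        using I(1) by (auto simp: E_def)
      then show ?thesis
        using g_less[of p] h_less[of l] n by (auto simp: h_def m_def)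
    qed
    then show ?thesis by (auto simp: ordered_graph_def G_def)
  qed
  moreover have "card (verts G) = n" by (simp add: G_def)
  ultimately have "card E \<in> {card (edges G) | G :: nat ograph.
     ordered_graph G \<and> card (verts G) = n \<and> (\<forall>H\<in>bordered_cycles 6. \<not> contains_ordered G H)}"
    by (auto simp: G_def intro!: exI[of _ G])
  then have "card E \<le> ex_ord n (bordered_cycles 6)"
    unfolding ex_ord_def by (rule Max_ge[OF ex_ord_candidates(1)])
  moreover have "card E = card I"
    unfolding E_def
  proof (rule card_image, rule inj_onI)
    fix e e' assume e: "e \<in> I" "e' \<in> I"
      and eq: "(case e of (p, l) \<Rightarrow> {g p, h l}) = (case e' of (p, l) \<Rightarrow> {g p, h l})"
    obtain p l p' l' where [simp]: "e = (p, l)" "e' = (p', l')" by fastforce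
    have "p \<in> P" "l \<in> L" "p' \<in> P" "l' \<in> L" using e I(1) by auto
    moreover from this have "g p = g p'" "h l = h l'"
      using eq g_less[of p] g_less[of p'] by (auto simp: doubleton_eq_iff h_def)
    ultimately show "e = e'" using inj_g inj_h by (simp add: inj_on_eq_iff)
  qed
  ultimately show ?thesis by simp
qed

lemma power_16_le_ex_ord:
  assumes "2 * 8 ^ k \<le> n" "k > 0"
  shows "16 ^ k \<le> ex_ord n (bordered_cycles 6)"
proof -
  obtain F :: "bit alg_closure set" where F: "finite F" "card F = 2 ^ k"
    "\<And>x y. x \<in> F \<Longrightarrow> y \<in> F \<Longrightarrow> x * y \<in> F" "\<And>x y. x \<in> F \<Longrightarrow> y \<in> F \<Longrightarrow> x - y \<in> F"
    using finite_subring_of_order_two_power[OF \<open>k > 0\<close>] by blast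
  let ?P = "F \<times> F \<times> F"
  have pow: "(2 ^ k) ^ 3 = (8::nat) ^ k" "(2 ^ k) ^ 4 = (16::nat) ^ k"
    by (simp_all flip: power_mult add: mult.commute[of k] add: power_mult)
  have "card ?P = 8 ^ k"
    using F(2) pow(1) by (simp add: card_cartesian_product power3_eq_cube mult.assoc)
  then have "card (wenger_incidence F) \<le> ex_ord n (bordered_cycles 6)"
    using F(1) assms(1)
    by (intro card_hexagon_free_le_ex_ord[of ?P ?P] wenger_no_hexagon)
      (auto simp: wenger_incidence_def)
  also have "card (wenger_incidence F) = 16 ^ k"
    using card_wenger_incidence[OF F(1,3,4)] F(2) pow(2) by simp
  finally show ?thesis by simp
qed

text \<open>With \<open>k\<close> maximal such that \<open>2 * 8 ^ k \<le> n\<close>, one has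
  \<open>n / 16 < 8 ^ k\<close>, and \<open>16 ^ k\<close> is the \<open>4 / 3\<close> power of
  \<open>8 ^ k\<close>. The hypothesis \<open>n \<ge> 16\<close> makes \<open>k\<close>
  positive.\<close>

lemma ex_ord_bordered_cycles_lower:
  assumes "n \<ge> 16"
  shows "(real n / 16) powr (4 / 3) \<le> real (ex_ord n (bordered_cycles 6))"
proof -
  obtain k where k: "8 ^ k \<le> n div 2" "n div 2 < 8 ^ (k + 1)"
  proof -
    have "1 \<le> n div 2" using assms by simp
    then show ?thesis using ex_power_ivl1[of 8 "n div 2"] that by auto
  qed
  have "k > 0" using k(2) assms by (cases k) auto
  have "n < 16 * 8 ^ k" using k(2) by simp
  then have "real n < real (16 * 8 ^ k)" by (simp only: of_nat_less_iff)
  then have "(real n / 16) powr (4 / 3) \<le> (8 ^ k) powr (4 / 3)"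
    by (intro powr_mono2) simp_all
  also have "(8 ^ k) powr (4 / 3) = (16::real) ^ k"
  proof -
    have "(8::real) ^ k = 2 powr (3 * real k)"
      using powr_realpow[of 2 "3 * k"] by (simp add: power_mult)
    then have "(8 ^ k) powr (4 / 3) = (2::real) powr (4 * real k)" by (simp add: powr_powr)
    also have "\<dots> = 16 ^ k"
      using powr_realpow[of 2 "4 * k"] by (simp add: power_mult)
    finally show ?thesis .
  qed
  also have "\<dots> \<le> real (ex_ord n (bordered_cycles 6))"
  proof -
    have "16 ^ k \<le> ex_ord n (bordered_cycles 6)"
      using k(1) \<open>k > 0\<close> by (intro power_16_le_ex_ord) simp_all
    then have "real (16 ^ k) \<le> real (ex_ord n (bordered_cycles 6))" by (simp only: of_nat_le_iff)
    then show ?thesis by simp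
  qed
  finally show ?thesis .
qed

theorem theorem3:
  shows "(\<lambda>n. real (ex_ord n (bordered_cycles 6))) \<in> \<Theta>(\<lambda>n. real n powr (4 / 3))"
proof (rule bigthetaI)
  show "(\<lambda>n. real (ex_ord n (bordered_cycles 6))) \<in> O(\<lambda>n. real n powr (4 / 3))"
    by (rule bigoI[of _ 8], rule eventually_mono[OF eventually_gt_at_top[of 0]])
      (use ex_ord_bordered_cycles_upper in auto)
  show "(\<lambda>n. real (ex_ord n (bordered_cycles 6))) \<in> \<Omega>(\<lambda>n. real n powr (4 / 3))"
  proof (rule landau_omega.bigI[of "(1 / 16) powr (4 / 3)"])
    show "\<forall>\<^sub>F n in sequentially. (1 / 16) powr (4 / 3) * norm (real n powr (4 / 3))
        \<le> norm (real (ex_ord n (bordered_cycles 6)))"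
      using eventually_ge_at_top[of 16]
    proof eventually_elim
      case (elim n)
      then show ?case
        using ex_ord_bordered_cycles_lower[of n] powr_mult[of "1 / 16" "real n" "4 / 3"] by simp
    qed
  qed simp
qed

end
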